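(* Let $\Omega,\Omega^*\subseteq\mathbb R^2$ be open and simply connected, $T:\Omega\to\Omega^*$ a $C^1$ bijective map, $Sx=Tx-x$, $a>0$, $\kappa_1=n_2/n_1>1$, and let $\rho:\Omega\to\mathbb R$. Then $\sigma_1=\{(x,\rho(x))\}_{x\in\Omega}$ is a $C^2$ surface (i.e. $\rho\in C^2(\Omega)$) lying between the planes $\{x_3=0\}$ and $\{x_3=a\}$, separating media I and II, and refracting, for every $x\in\Omega$, the vertical ray emitted from $(x,0)$ in medium I into the point $(Tx,a)$ in medium II, if and only if $$a>a-\rho(x)>\frac{|Sx|}{\sqrt{\kappa_1^2-1}}\qquad\text{for every }x\in\Omega,$$ and $\rho$ is differentiable and satisfies the system of PDEs $$D\rho(x)=\frac{\kappa_1\,Sx}{\sqrt{|Sx|^2+(a-\rho(x))^2}-\kappa_1(a-\rho(x))}\qquad\text{for every }x\in\Omega.$$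
   Context: Vectors are row vectors and $D\rho$ is the row gradient. Medium I (below $\sigma_1$) has refractive index $n_1$ and medium II (above $\sigma_1$) has refractive index $n_2>n_1$. "Between the planes" means $0<\rho<a$. The upward unit normal to $\sigma_1$ at $(x,\rho(x))$ is $\nu(x)=\dfrac{(-D\rho(x),1)}{\sqrt{1+|D\rho(x)|^2}}$. A vertical ray with direction ${\bf e}=(0,0,1)$ striking $\sigma_1$ at $(x,\rho(x))$ is refracted, by Snell's law, into the unit direction $${\bf m}(x)=\frac1{\kappa_1}({\bf e}-\lambda\nu(x)),\qquad\lambda={\bf e}\cdot\nu(x)-\sqrt{\kappa_1^2-1+({\bf e}\cdot\nu(x))^2}.$$ The ray is refracted into the point $(Tx,a)$ if ${\bf m}(x)=\dfrac{(Tx,a)-(x,\rho(x))}{|(Tx,a)-(x,\rho(x))|}$. *)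

theory Defs
  imports "HOL-Analysis.Analysis"
begin

text \<open>
  Points of \<open>\<real>\<^sup>3\<close> are pairs \<open>(x, z) :: (real ^ 2) \<times> real\<close>; the product type carries the Euclidean
  inner product and norm.  Functions on an open set \<open>\<Omega>\<close> are total functions of which only the
  values on \<open>\<Omega>\<close> matter.
\<close>

type_synonym point3 = "(real ^ 2) \<times> real"

text \<open>The gradient; it is unspecified at points where \<open>f\<close> is not differentiable.\<close>

definition grad :: "('a::real_inner \<Rightarrow> real) \<Rightarrow> 'a \<Rightarrow> 'a" where
  "grad f x = (THE D. GDERIV f x :> D)"

text \<open>
  \<open>C\<^sup>1\<close> and \<open>C\<^sup>2\<close> regularity, to be used on open sets only (derivatives are two-sided).  Continuity of
  the derivative is with respect to the operator norm.
\<close>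

definition C1_on :: "'a::real_normed_vector set \<Rightarrow> ('a \<Rightarrow> 'b::real_normed_vector) \<Rightarrow> bool" where
  "C1_on \<Omega> f \<longleftrightarrow>
     (\<exists>f' :: 'a \<Rightarrow> 'a \<Rightarrow>\<^sub>L 'b.
        (\<forall>x\<in>\<Omega>. (f has_derivative blinfun_apply (f' x)) (at x)) \<and> continuous_on \<Omega> f')"

definition C2_on :: "'a::real_inner set \<Rightarrow> ('a \<Rightarrow> real) \<Rightarrow> bool" where
  "C2_on \<Omega> f \<longleftrightarrow> f differentiable_on \<Omega> \<and> C1_on \<Omega> (grad f)"

definition vertical :: point3 where
  "vertical = (0, 1)"

text \<open>
  The unit normal at \<open>(x, \<rho> x)\<close> to the graph of \<open>\<rho>\<close>.  It points upwards, that is, from medium I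
  (below the graph, index \<open>n\<^sub>1\<close>) into medium II (above the graph, index \<open>n\<^sub>2\<close>).
\<close>

definition unit_normal :: "(real ^ 2 \<Rightarrow> real) \<Rightarrow> real ^ 2 \<Rightarrow> point3" where
  "unit_normal \<rho> x = (1 / sqrt (1 + (norm (grad \<rho> x))\<^sup>2)) *\<^sub>R (- grad \<rho> x, 1)"

text \<open>
  Snell's law in vector form, with \<open>\<kappa> = n\<^sub>2 / n\<^sub>1\<close>: the direction into which the vertical ray
  striking the graph of \<open>\<rho>\<close> from below at \<open>(x, \<rho> x)\<close> is refracted.
\<close>

definition refraction_coeff :: "real \<Rightarrow> (real ^ 2 \<Rightarrow> real) \<Rightarrow> real ^ 2 \<Rightarrow> real" where
  "refraction_coeff \<kappa> \<rho> x =
     vertical \<bullet> unit_normal \<rho> x - sqrt (\<kappa>\<^sup>2 - 1 + (vertical \<bullet> unit_normal \<rho> x)\<^sup>2)"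

definition refracted_dir :: "real \<Rightarrow> (real ^ 2 \<Rightarrow> real) \<Rightarrow> real ^ 2 \<Rightarrow> point3" where
  "refracted_dir \<kappa> \<rho> x =
     (1 / \<kappa>) *\<^sub>R (vertical - refraction_coeff \<kappa> \<rho> x *\<^sub>R unit_normal \<rho> x)"

text \<open>
  The vertical ray emitted from \<open>(x, 0)\<close> meets the graph of \<open>\<rho>\<close> at \<open>(x, \<rho> x)\<close>, where it is
  refracted into the point \<open>q\<close>.
\<close>

definition refracts_into :: "real \<Rightarrow> (real ^ 2 \<Rightarrow> real) \<Rightarrow> real ^ 2 \<Rightarrow> point3 \<Rightarrow> bool" where
  "refracts_into \<kappa> \<rho> x q \<longleftrightarrow>
     refracted_dir \<kappa> \<rho> x = (1 / norm (q - (x, \<rho> x))) *\<^sub>R (q - (x, \<rho> x))"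

end

theory Submission imports Defs begin

text \<open>Fix x and put p = \<open>grad \<rho> x\<close>, s = T x - x, d = a - \<rho> x > 0 and N
  = |(s, d)|. Snell's law sends the vertical ray into the direction (- \<mu> p, 1 + \<mu>) /
  \<kappa>, where \<mu> > 0 because \<kappa> > 1 (\<open>refracted_dir_cases\<close>). Equate this
  with (s, d) / N: the vertical component gives \<mu> = (\<kappa> d - N) / N, the horizontal one
  then gives p = \<kappa> s / (N - \<kappa> d), which is the system, and \<mu> > 0 says N < \<kappa>
  d, which is the bound on |s| (\<open>refraction_cone_iff\<close>). Conversely, the system and the
  bound force \<mu> to have this value, because the refracted direction is a unit vector. So
  refraction is equivalent, point by point, to the system together with the bound
  (\<open>refracts_into_iff\<close>).

  It remains to see that a differentiable solution is C2. The bound keeps the denominator nonzero,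
  so the right-hand side of the system inherits continuity, and then C1 regularity, from \<rho> and
  S.\<close>

section \<open>Calculus of C1 maps\<close>

lemma C1_on_cong:
  assumes "open \<Omega>" "C1_on \<Omega> g" "\<And>x. x \<in> \<Omega> \<Longrightarrow> f x = g x"
  shows "C1_on \<Omega> f"
proof -
  obtain g' where g': "\<And>x. x \<in> \<Omega> \<Longrightarrow> (g has_derivative blinfun_apply (g' x)) (at x)"
    and cont: "continuous_on \<Omega> g'"
    using assms(2) unfolding C1_on_def by blast
  have "(f has_derivative blinfun_apply (g' x)) (at x)" if "x \<in> \<Omega>" for x
    using has_derivative_transform_within_open[OF g'[OF that] assms(1) that] assms(3) by auto
  with cont show ?thesis
    unfolding C1_on_def by blast
qed

lemma C1_on_imp_continuous_on:
  assumes "C1_on \<Omega> f"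
  shows "continuous_on \<Omega> f"
  using assms unfolding C1_on_def
  by (blast intro: continuous_at_imp_continuous_on has_derivative_continuous)

lemma C1_on_const: "C1_on \<Omega> (\<lambda>x. c)"
  unfolding C1_on_def by (intro exI[of _ "\<lambda>x. 0"]) (auto simp: zero_blinfun.rep_eq)

lemma C1_on_ident: "C1_on \<Omega> (\<lambda>x. x)"
  unfolding C1_on_def by (intro exI[of _ "\<lambda>x. id_blinfun"]) auto

lemma C1_on_add:
  assumes "C1_on \<Omega> f" "C1_on \<Omega> g"
  shows "C1_on \<Omega> (\<lambda>x. f x + g x)"
proof -
  obtain f' g' where
    "\<And>x. x \<in> \<Omega> \<Longrightarrow> (f has_derivative blinfun_apply (f' x)) (at x)" "continuous_on \<Omega> f'"
    "\<And>x. x \<in> \<Omega> \<Longrightarrow> (g has_derivative blinfun_apply (g' x)) (at x)" "continuous_on \<Omega> g'"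
    using assms unfolding C1_on_def by blast
  then show ?thesis
    unfolding C1_on_def
    by (intro exI[of _ "\<lambda>x. f' x + g' x"])
      (auto simp: plus_blinfun.rep_eq intro!: derivative_eq_intros continuous_intros)
qed

lemma C1_on_scaleR:
  assumes "C1_on \<Omega> f" "C1_on \<Omega> g"
  shows "C1_on \<Omega> (\<lambda>x. f x *\<^sub>R g x)"
proof -
  obtain f' g' where
    "\<And>x. x \<in> \<Omega> \<Longrightarrow> (f has_derivative blinfun_apply (f' x)) (at x)" "continuous_on \<Omega> f'"
    "\<And>x. x \<in> \<Omega> \<Longrightarrow> (g has_derivative blinfun_apply (g' x)) (at x)" "continuous_on \<Omega> g'"
    using assms unfolding C1_on_def by blast
  then show ?thesis
    using C1_on_imp_continuous_on[OF assms(1)] C1_on_imp_continuous_on[OF assms(2)]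
    unfolding C1_on_def
    \<comment> \<open>The Leibniz rule as a bounded linear map: the second summand sends h to (f' x
      h) g x.\<close>
    by (intro exI[of _ "\<lambda>x. f x *\<^sub>R g' x + (blinfun_scaleR_left (g x) o\<^sub>L f' x)"])
      (auto simp: plus_blinfun.rep_eq scaleR_blinfun.rep_eq
        intro!: derivative_eq_intros continuous_intros)
qed

lemma C1_on_diff:
  assumes "C1_on \<Omega> f" "C1_on \<Omega> g"
  shows "C1_on \<Omega> (\<lambda>x. f x - g x)"
  using C1_on_add[OF assms(1) C1_on_scaleR[OF C1_on_const[of \<Omega> "-1::real"] assms(2)]] by simp

lemma C1_on_power2_norm:
  fixes f :: "'a::real_normed_vector \<Rightarrow> 'b::real_inner"
  assumes "C1_on \<Omega> f"
  shows "C1_on \<Omega> (\<lambda>x. (norm (f x))\<^sup>2)"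
proof -
  obtain f' where
    "\<And>x. x \<in> \<Omega> \<Longrightarrow> (f has_derivative blinfun_apply (f' x)) (at x)" "continuous_on \<Omega> f'"
    using assms unfolding C1_on_def by blast
  then show ?thesis
    using C1_on_imp_continuous_on[OF assms]
    unfolding C1_on_def power2_norm_eq_inner
    by (intro exI[of _ "\<lambda>x. 2 *\<^sub>R (blinfun_inner_right (f x) o\<^sub>L f' x)"])
      (auto simp: scaleR_blinfun.rep_eq inner_commute
        intro!: derivative_eq_intros continuous_intros)
qed

text \<open>Chain rule with the outer derivative controlled only on the image of f, so that it
  covers square root and inverse away from their singularity at 0.\<close>

lemma C1_on_real_compose:
  fixes h h' :: "real \<Rightarrow> real"
  assumes "C1_on \<Omega> f" "\<And>x. x \<in> \<Omega> \<Longrightarrow> (h has_real_derivative h' (f x)) (at (f x))"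
    and "continuous_on (f ` \<Omega>) h'"
  shows "C1_on \<Omega> (\<lambda>x. h (f x))"
proof -
  obtain f' where f':
    "\<And>x. x \<in> \<Omega> \<Longrightarrow> (f has_derivative blinfun_apply (f' x)) (at x)" "continuous_on \<Omega> f'"
    using assms(1) unfolding C1_on_def by blast
  have "((\<lambda>x. h (f x)) has_derivative blinfun_apply (h' (f x) *\<^sub>R f' x)) (at x)" if "x \<in> \<Omega>" for x
    using has_derivative_compose[OF f'(1)[OF that]
        assms(2)[OF that, unfolded has_field_derivative_def]]
    by (simp add: scaleR_blinfun.rep_eq)
  moreover have "continuous_on \<Omega> (\<lambda>x. h' (f x) *\<^sub>R f' x)"
    using continuous_on_compose[OF C1_on_imp_continuous_on[OF assms(1)] assms(3)] f'(2)
    by (auto simp: o_def intro!: continuous_intros)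
  ultimately show ?thesis
    unfolding C1_on_def by (intro exI[of _ "\<lambda>x. h' (f x) *\<^sub>R f' x"]) auto
qed

lemma C1_on_sqrt:
  assumes "C1_on \<Omega> f" "\<And>x. x \<in> \<Omega> \<Longrightarrow> 0 < f x"
  shows "C1_on \<Omega> (\<lambda>x. sqrt (f x))"
  by (rule C1_on_real_compose[OF assms(1), where h' = "\<lambda>y. inverse (sqrt y) / 2"])
    (auto dest!: assms(2) intro!: DERIV_real_sqrt continuous_intros)

lemma C1_on_inverse:
  fixes f :: "'a::real_normed_vector \<Rightarrow> real"
  assumes "C1_on \<Omega> f" "\<And>x. x \<in> \<Omega> \<Longrightarrow> f x \<noteq> 0"
  shows "C1_on \<Omega> (\<lambda>x. inverse (f x))"
  by (rule C1_on_real_compose[OF assms(1), where h' = "\<lambda>y. - (inverse y ^ Suc (Suc 0))"])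
    (use assms(2) in \<open>auto intro!: DERIV_inverse continuous_intros simp del: power_Suc\<close>)

section \<open>Gradients\<close>

text \<open>The derivative, a linear functional, is represented by a vector read off from an
  orthonormal basis. This vector is unique, so the definite description in \<open>grad\<close>
  denotes it.\<close>

lemma GDERIV_grad:
  fixes f :: "'a::euclidean_space \<Rightarrow> real"
  assumes "f differentiable at x"
  shows "GDERIV f x :> grad f x"
proof -
  obtain f' where f': "(f has_derivative f') (at x)"
    using assms unfolding differentiable_def by blast
  interpret f': bounded_linear f'
    using f' by (rule has_derivative_bounded_linear)
  have "f' h = h \<bullet> (\<Sum>b\<in>Basis. f' b *\<^sub>R b)" for h
  proof -
    have "f' h = f' (\<Sum>b\<in>Basis. (h \<bullet> b) *\<^sub>R b)"
      by (simp add: euclidean_representation)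
    then show ?thesis
      by (simp add: f'.sum f'.scaleR inner_sum_right mult.commute)
  qed
  then have "f' = (\<lambda>h. h \<bullet> (\<Sum>b\<in>Basis. f' b *\<^sub>R b))"
    by (rule ext)
  with f' have D: "GDERIV f x :> (\<Sum>b\<in>Basis. f' b *\<^sub>R b)"
    unfolding gderiv_def by (rule back_subst)
  have unique: "D1 = D2" if "GDERIV f x :> D1" "GDERIV f x :> D2" for D1 D2
  proof -
    have "(\<lambda>h. h \<bullet> D1) = (\<lambda>h. h \<bullet> D2)"
      using that unfolding gderiv_def by (rule has_derivative_unique)
    then have "\<forall>h. h \<bullet> D1 = h \<bullet> D2"
      by (simp add: fun_eq_iff)
    then show ?thesis
      by (simp only: vector_eq_ldot)
  qed
  show ?thesis
    unfolding grad_def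
    by (rule theI[where P = "\<lambda>D. GDERIV f x :> D", OF D]) (rule unique[OF _ D])
qed

text \<open>The derivative is the image of the gradient under the bounded linear map
  \<open>blinfun_inner_right\<close>, so continuity passes to the operator norm.\<close>

lemma C1_on_continuous_grad:
  fixes f :: "'a::euclidean_space \<Rightarrow> real"
  assumes "open \<Omega>" "f differentiable_on \<Omega>" "continuous_on \<Omega> (grad f)"
  shows "C1_on \<Omega> f"
proof -
  have "(f has_derivative blinfun_apply (blinfun_inner_right (grad f x))) (at x)"
    if "x \<in> \<Omega>" for x
  proof -
    have "GDERIV f x :> grad f x"
      using assms that by (simp add: GDERIV_grad differentiable_on_eq_differentiable_at)
    moreover have "(\<lambda>h. h \<bullet> grad f x) = blinfun_apply (blinfun_inner_right (grad f x))"
      by (simp add: fun_eq_iff inner_commute)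
    ultimately show ?thesis
      unfolding gderiv_def by simp
  qed
  then show ?thesis
    using assms(3) unfolding C1_on_def
    by (intro exI[of _ "\<lambda>x. blinfun_inner_right (grad f x)"]) (auto intro!: continuous_intros)
qed

section \<open>Snell's law at a single point\<close>

text \<open>
  The last equation says that the refracted direction is a unit vector.  Its left-hand side is
  increasing in \<open>\<mu> > 0\<close>, so it determines \<open>\<mu>\<close>.
\<close>

lemma refracted_dir_cases:
  assumes "\<kappa> > 1"
  obtains \<mu> where "\<mu> > 0"
    and "refracted_dir \<kappa> \<rho> x = (1 / \<kappa>) *\<^sub>R (- \<mu> *\<^sub>R grad \<rho> x, 1 + \<mu>)"
    and "\<mu>\<^sup>2 * (1 + (norm (grad \<rho> x))\<^sup>2) + 2 * \<mu> + 1 = \<kappa>\<^sup>2"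
proof -
  define W where "W = sqrt (1 + (norm (grad \<rho> x))\<^sup>2)"
  have W2: "W\<^sup>2 = 1 + (norm (grad \<rho> x))\<^sup>2" and W: "W > 0"
    by (simp_all add: W_def add_pos_nonneg)
  have nu: "unit_normal \<rho> x = (1 / W) *\<^sub>R (- grad \<rho> x, 1)"
    by (simp add: unit_normal_def W_def)
  have ip: "vertical \<bullet> unit_normal \<rho> x = 1 / W"
    by (simp add: nu vertical_def)
  define L where "L = refraction_coeff \<kappa> \<rho> x"
  have k: "\<kappa>\<^sup>2 - 1 > 0"
    using assms by simp
  define Q where "Q = sqrt (\<kappa>\<^sup>2 - 1 + (1 / W)\<^sup>2)"
  have Q2: "Q\<^sup>2 = \<kappa>\<^sup>2 - 1 + (1 / W)\<^sup>2"
    using k by (simp add: Q_def)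
  have L: "L = 1 / W - Q"
    by (simp add: L_def refraction_coeff_def ip Q_def)
  have "1 / W < Q"
    unfolding Q_def using k by (intro real_less_rsqrt) auto
  then have "L < 0"
    by (simp add: L)
  show thesis
  proof
    \<comment> \<open>The witness \<mu> is minus the refraction coefficient, divided by W to absorb
      the normalisation of the normal.\<close>
    show "- L / W > 0"
      using \<open>L < 0\<close> W by (simp add: divide_neg_pos)
    show "refracted_dir \<kappa> \<rho> x = (1 / \<kappa>) *\<^sub>R (- (- L / W) *\<^sub>R grad \<rho> x, 1 + - L / W)"
      by (simp add: refracted_dir_def L_def[symmetric] nu vertical_def)
    \<comment> \<open>Completing the square in L: the square on the right is that of the root
      Q.\<close>
    have "(- L / W)\<^sup>2 * W\<^sup>2 + 2 * (- L / W) + 1 = (L - 1 / W)\<^sup>2 + 1 - (1 / W)\<^sup>2"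
      using W by (simp add: field_simps power2_eq_square)
    also have "\<dots> = \<kappa>\<^sup>2"
      using Q2 by (simp add: L)
    finally show "(- L / W)\<^sup>2 * (1 + (norm (grad \<rho> x))\<^sup>2) + 2 * (- L / W) + 1 = \<kappa>\<^sup>2"
      by (simp add: W2)
  qed
qed

text \<open>Both sides say that (s, d) makes an angle with the vertical whose cosine exceeds 1 /
  \<kappa>; the tangent of the limiting angle is \<open>sqrt (\<kappa>\<^sup>2 - 1)\<close>.\<close>

lemma refraction_cone_iff:
  fixes s d \<kappa> :: real
  assumes "\<kappa> > 1" "d > 0" "s \<ge> 0"
  shows "s / sqrt (\<kappa>\<^sup>2 - 1) < d \<longleftrightarrow> sqrt (s\<^sup>2 + d\<^sup>2) < \<kappa> * d"
proof -
  have k: "\<kappa>\<^sup>2 - 1 > 0"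
    using assms by simp
  have "s / sqrt (\<kappa>\<^sup>2 - 1) < d \<longleftrightarrow> s < d * sqrt (\<kappa>\<^sup>2 - 1)"
    using k by (simp add: pos_divide_less_eq)
  also have "\<dots> \<longleftrightarrow> s\<^sup>2 < (d * sqrt (\<kappa>\<^sup>2 - 1))\<^sup>2"
    using assms k by (auto intro: power_strict_mono power2_less_imp_less)
  also have "\<dots> \<longleftrightarrow> s\<^sup>2 + d\<^sup>2 < (\<kappa> * d)\<^sup>2"
    using k by (simp add: power_mult_distrib algebra_simps)
  also have "\<dots> \<longleftrightarrow> sqrt (s\<^sup>2 + d\<^sup>2) < \<kappa> * d"
    using assms real_sqrt_less_iff[of "s\<^sup>2 + d\<^sup>2" "(\<kappa> * d)\<^sup>2"] by simp
  finally show ?thesis .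
qed

text \<open>A purely algebraic statement about the vector \<open>grad \<rho> x\<close>;
  differentiability of \<rho> does not enter.\<close>

lemma refracts_into_iff:
  fixes y :: "real ^ 2"
  assumes "\<kappa> > 1" "\<rho> x < a"
  shows "refracts_into \<kappa> \<rho> x (y, a) \<longleftrightarrow>
     norm (y - x) / sqrt (\<kappa>\<^sup>2 - 1) < a - \<rho> x \<and>
     grad \<rho> x =
       (\<kappa> / (sqrt ((norm (y - x))\<^sup>2 + (a - \<rho> x)\<^sup>2) - \<kappa> * (a - \<rho> x))) *\<^sub>R (y - x)"
    (is "?L \<longleftrightarrow> ?R")
proof -
  define p where "p = grad \<rho> x"
  define s where "s = y - x"
  define d where "d = a - \<rho> x"
  define N where "N = sqrt ((norm s)\<^sup>2 + d\<^sup>2)"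
  have d: "d > 0"
    using assms by (simp add: d_def)
  have N: "N > 0" and N2: "N\<^sup>2 = (norm s)\<^sup>2 + d\<^sup>2"
    using d by (simp_all add: N_def add_nonneg_pos)
  obtain \<mu> where \<mu>: "\<mu> > 0"
    and dir: "refracted_dir \<kappa> \<rho> x = (1 / \<kappa>) *\<^sub>R (- \<mu> *\<^sub>R p, 1 + \<mu>)"
    and eq: "\<mu>\<^sup>2 * (1 + (norm p)\<^sup>2) + 2 * \<mu> + 1 = \<kappa>\<^sup>2"
    using refracted_dir_cases[OF assms(1)] unfolding p_def by metis
  have "?L \<longleftrightarrow> (1 / \<kappa>) *\<^sub>R (- \<mu> *\<^sub>R p, 1 + \<mu>) = (1 / N) *\<^sub>R (s, d)"
    by (simp add: refracts_into_def dir s_def d_def N_def norm_Pair)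
  also have "\<dots> \<longleftrightarrow> \<kappa> *\<^sub>R (1 / \<kappa>) *\<^sub>R (- \<mu> *\<^sub>R p, 1 + \<mu>) = \<kappa> *\<^sub>R (1 / N) *\<^sub>R (s, d)"
    using assms(1) by (subst scaleR_cancel_left) auto
  also have "\<dots> \<longleftrightarrow> - \<mu> *\<^sub>R p = (\<kappa> / N) *\<^sub>R s \<and> 1 + \<mu> = \<kappa> * d / N"
    using assms(1) by simp
  also have "\<dots> \<longleftrightarrow> N < \<kappa> * d \<and> p = (\<kappa> / (N - \<kappa> * d)) *\<^sub>R s"
  proof (intro iffI conjI; elim conjE)
    assume h: "- \<mu> *\<^sub>R p = (\<kappa> / N) *\<^sub>R s" and v: "1 + \<mu> = \<kappa> * d / N"
    from v have c: "\<kappa> * d - N = \<mu> * N"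
      using N by (simp add: field_simps)
    show "N < \<kappa> * d"
      using c mult_pos_pos[OF \<mu> N] by linarith
    have "p = (- 1 / \<mu>) *\<^sub>R (- \<mu> *\<^sub>R p)"
      using \<mu> by simp
    also have "\<dots> = (\<kappa> / (- (\<mu> * N))) *\<^sub>R s"
      unfolding h by simp
    also have "- (\<mu> * N) = N - \<kappa> * d"
      using c by simp
    finally show "p = (\<kappa> / (N - \<kappa> * d)) *\<^sub>R s" .
  next
    assume lt: "N < \<kappa> * d" and p: "p = (\<kappa> / (N - \<kappa> * d)) *\<^sub>R s"
    define c where "c = \<kappa> * d - N"
    have c: "c > 0"
      using lt by (simp add: c_def)
    have p': "p = (- (\<kappa> / c)) *\<^sub>R s"
      using p c by (simp add: c_def minus_divide_right)
    have np: "(norm p)\<^sup>2 = \<kappa>\<^sup>2 * (norm s)\<^sup>2 / c\<^sup>2"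
      by (simp add: p' power_mult_distrib power_divide)
    \<comment> \<open>The value that the vertical component requires. It is shown to solve the
      unit-length equation of \<mu>.\<close>
    define \<mu>' where "\<mu>' = c / N"
    have \<mu>': "\<mu>' > 0"
      using c N by (simp add: \<mu>'_def)
    have "N\<^sup>2 * (\<mu>'\<^sup>2 * (1 + (norm p)\<^sup>2) + 2 * \<mu>' + 1) = (c + N)\<^sup>2 + \<kappa>\<^sup>2 * (norm s)\<^sup>2"
      unfolding np \<mu>'_def using c N by (simp add: field_simps power2_eq_square)
    also have "\<dots> = N\<^sup>2 * \<kappa>\<^sup>2"
      by (simp add: c_def N2 power_mult_distrib algebra_simps)
    finally have eq': "\<mu>'\<^sup>2 * (1 + (norm p)\<^sup>2) + 2 * \<mu>' + 1 = \<kappa>\<^sup>2"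
      using N by simp
    \<comment> \<open>Subtracting the two quadratic equations; the cofactor of the difference is
      positive, so the roots agree.\<close>
    have "(\<mu> - \<mu>') * ((\<mu> + \<mu>') * (1 + (norm p)\<^sup>2) + 2) = 0"
      using eq eq' by (simp add: algebra_simps power2_eq_square)
    moreover have "(\<mu> + \<mu>') * (1 + (norm p)\<^sup>2) + 2 > 0"
      using \<mu> \<mu>' by (intro add_nonneg_pos mult_nonneg_nonneg) auto
    ultimately have \<mu>_eq: "\<mu> = c / N"
      by (simp add: \<mu>'_def)
    show "- \<mu> *\<^sub>R p = (\<kappa> / N) *\<^sub>R s"
      unfolding \<mu>_eq p' using c by simp
    show "1 + \<mu> = \<kappa> * d / N"
      unfolding \<mu>_eq c_def using N by (simp add: field_simps)
  qed
  also have "\<dots> \<longleftrightarrow> ?R"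
    using refraction_cone_iff[OF assms(1) d, of "norm s"] by (simp add: N_def p_def s_def d_def)
  finally show ?thesis .
qed

section \<open>The equivalence and the regularity of solutions\<close>

theorem proposition4p1:
  fixes \<Omega> \<Omega>s :: "(real ^ 2) set"
    and T S :: "real ^ 2 \<Rightarrow> real ^ 2"
    and \<rho> :: "real ^ 2 \<Rightarrow> real"
    and a n1 n2 \<kappa>1 :: real
  assumes "open \<Omega>" and "simply_connected \<Omega>"
    and "open \<Omega>s" and "simply_connected \<Omega>s"
    and "C1_on \<Omega> T" and "bij_betw T \<Omega> \<Omega>s"
    and "\<And>x. x \<in> \<Omega> \<Longrightarrow> S x = T x - x"
    and "a > 0"
    and "0 < n1" and "n1 < n2" and "\<kappa>1 = n2 / n1"
  shows "(C2_on \<Omega> \<rho> \<and>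
          (\<forall>x\<in>\<Omega>. 0 < \<rho> x \<and> \<rho> x < a) \<and>
          (\<forall>x\<in>\<Omega>. refracts_into \<kappa>1 \<rho> x (T x, a)))
     \<longleftrightarrow>
         ((\<forall>x\<in>\<Omega>. a > a - \<rho> x \<and> a - \<rho> x > norm (S x) / sqrt (\<kappa>1\<^sup>2 - 1)) \<and>
          \<rho> differentiable_on \<Omega> \<and>
          (\<forall>x\<in>\<Omega>. grad \<rho> x =
             (\<kappa>1 / (sqrt ((norm (S x))\<^sup>2 + (a - \<rho> x)\<^sup>2) - \<kappa>1 * (a - \<rho> x))) *\<^sub>R S x))"
  (is "?refr \<longleftrightarrow> ?pde")
proof -
  have \<kappa>: "\<kappa>1 > 1"
    using assms(9-11) by simp
  have refr: "refracts_into \<kappa>1 \<rho> x (T x, a) \<longleftrightarrow>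
      norm (S x) / sqrt (\<kappa>1\<^sup>2 - 1) < a - \<rho> x \<and>
      grad \<rho> x =
        (\<kappa>1 / (sqrt ((norm (S x))\<^sup>2 + (a - \<rho> x)\<^sup>2) - \<kappa>1 * (a - \<rho> x))) *\<^sub>R S x"
    if "x \<in> \<Omega>" "\<rho> x < a" for x
    using refracts_into_iff[where \<rho> = \<rho> and x = x and a = a, OF \<kappa> that(2)] assms(7)[OF that(1)] by simp
  show ?thesis
  proof
    assume ?refr
    then show ?pde
      using refr by (auto simp: C2_on_def)
  next
    assume pde: ?pde
    have below: "\<rho> x < a" if "x \<in> \<Omega>" for x
    proof -
      have "0 \<le> norm (S x) / sqrt (\<kappa>1\<^sup>2 - 1)"
        using \<kappa> by simp
      also have "\<dots> < a - \<rho> x"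
        using pde that by blast
      finally show ?thesis
        by simp
    qed
    \<comment> \<open>The scalar factor is split into a constant and an \<open>inverse\<close>, to
      match \<open>C1_on_scaleR\<close> and \<open>C1_on_inverse\<close>.\<close>
    define G where "G x = inverse (sqrt ((norm (S x))\<^sup>2 + (a - \<rho> x)\<^sup>2) - \<kappa>1 * (a - \<rho> x))" for x
    have grad_eq: "grad \<rho> x = (\<kappa>1 *\<^sub>R G x) *\<^sub>R S x" if "x \<in> \<Omega>" for x
      using pde that by (simp add: G_def divide_inverse)
    have pos: "0 < (norm (S x))\<^sup>2 + (a - \<rho> x)\<^sup>2" if "x \<in> \<Omega>" for x
      using below[OF that] by (intro add_nonneg_pos) auto
    \<comment> \<open>The bound in the hypothesis makes the denominator negative.\<close>
    have denom: "sqrt ((norm (S x))\<^sup>2 + (a - \<rho> x)\<^sup>2) - \<kappa>1 * (a - \<rho> x) \<noteq> 0" if "x \<in> \<Omega>" for x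
      using refraction_cone_iff[OF \<kappa>, of "a - \<rho> x" "norm (S x)"] below[OF that] pde that by force
    have S: "C1_on \<Omega> S"
      using C1_on_cong[OF assms(1) C1_on_diff[OF assms(5) C1_on_ident]] assms(7) by simp
    have "continuous_on \<Omega> \<rho>"
      using pde by (simp add: differentiable_imp_continuous_on)
    then have "continuous_on \<Omega> (\<lambda>x. (\<kappa>1 *\<^sub>R G x) *\<^sub>R S x)"
      unfolding G_def using C1_on_imp_continuous_on[OF S] denom
      by (intro continuous_intros) auto
    then have "continuous_on \<Omega> (grad \<rho>)"
      using grad_eq by (simp cong: continuous_on_cong)
    \<comment> \<open>Bootstrapping: the right-hand side of the system is continuous, so \<open>\<rho>\<close> is \<open>C\<^sup>1\<close>; hence the
      right-hand side is \<open>C\<^sup>1\<close>, so \<open>\<rho>\<close> is \<open>C\<^sup>2\<close>.\<close>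
    then have \<rho>: "C1_on \<Omega> \<rho>"
      using C1_on_continuous_grad[OF assms(1)] pde by blast
    have d: "C1_on \<Omega> (\<lambda>x. a - \<rho> x)"
      by (intro C1_on_diff C1_on_const \<rho>)
    have "C1_on \<Omega> (\<lambda>x. (norm (S x))\<^sup>2 + (a - \<rho> x)\<^sup>2)"
      using C1_on_add[OF C1_on_power2_norm[OF S] C1_on_power2_norm[OF d]] by simp
    then have "C1_on \<Omega> (\<lambda>x. sqrt ((norm (S x))\<^sup>2 + (a - \<rho> x)\<^sup>2) - \<kappa>1 *\<^sub>R (a - \<rho> x))"
      using pos by (intro C1_on_diff C1_on_sqrt C1_on_scaleR C1_on_const \<rho>) auto
    then have "C1_on \<Omega> G"
      unfolding G_def using denom by (intro C1_on_inverse) auto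
    then have "C1_on \<Omega> (\<lambda>x. (\<kappa>1 *\<^sub>R G x) *\<^sub>R S x)"
      by (intro C1_on_scaleR C1_on_const S)
    then have "C1_on \<Omega> (grad \<rho>)"
      by (rule C1_on_cong[OF assms(1) _ grad_eq])
    then show ?refr
      using pde below refr by (auto simp: C2_on_def)
  qed
qed

end
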